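(* Let $u\in U_T$ be a constant control, and let $X=\Phi\circ z$ (with $z$ a curve in the star domain $\mathfrak h^\star$) be a solution of $X'=[Z_u,X]/\langle Z_u,X\rangle$. Then the speed $\langle X',X'\rangle^{1/2}$ of $X$ is constant. Moreover, the trajectory $z$ in the upper half-plane $\mathfrak h$ has constant speed with respect to the invariant Riemannian metric $(dx^2+dy^2)/y^2$ on $\mathfrak h$.
   Context: $\langle X,Y\rangle=\mathrm{trace}(XY)$ and $[X,Y]=XY-YX$ on $\mathfrak{sl}_2(\mathbb R)$. $U_T=\{(u_0,u_1,u_2):u_i\ge0,\sum u_i=1\}$, $Z_u=\begin{pmatrix}\frac{u_1-u_2}{\sqrt3}&\frac{u_0-2u_1-2u_2}{3}\\ u_0&\frac{u_2-u_1}{\sqrt3}\end{pmatrix}$. For $z=x+iy\in\mathfrak h$ (upper half-plane), $\Phi(z)=\begin{pmatrix}x/y&-(x^2+y^2)/y\\ 1/y&-x/y\end{pmatrix}$. Star domain: $\mathfrak h^\star=\{x+iy:y>0,|x|<1/\sqrt3,x^2+y^2>1/3\}$; for $z\in\mathfrak h^\star$ one has $\langle Z_u,\Phi(z)\rangle<0$ for all $u\in U_T$. *)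

theory Defs
  imports "HOL-Analysis.Analysis"
begin

definition trace_form :: "real^2^2 \<Rightarrow> real^2^2 \<Rightarrow> real" where
  "trace_form X Y = trace (X ** Y)"

definition bracket :: "real^2^2 \<Rightarrow> real^2^2 \<Rightarrow> real^2^2" where
  "bracket X Y = X ** Y - Y ** X"

definition sl2 :: "(real^2^2) set" where
  "sl2 = {X. trace X = 0}"

definition U_T :: "(real \<times> real \<times> real) set" where
  "U_T = {(u0, u1, u2). 0 \<le> u0 \<and> 0 \<le> u1 \<and> 0 \<le> u2 \<and> u0 + u1 + u2 = 1}"

fun Z_mat :: "real \<times> real \<times> real \<Rightarrow> real^2^2" where
  "Z_mat (u0, u1, u2) = vector
     [vector [(u1 - u2) / sqrt 3, (u0 - 2 * u1 - 2 * u2) / 3],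
      vector [u0, (u2 - u1) / sqrt 3]]"

definition Phi :: "complex \<Rightarrow> real^2^2" where
  "Phi z = vector
     [vector [Re z / Im z, - ((Re z)\<^sup>2 + (Im z)\<^sup>2) / Im z],
      vector [1 / Im z, - Re z / Im z]]"

definition h_star :: "complex set" where
  "h_star = {z. 0 < Im z \<and> \<bar>Re z\<bar> < 1 / sqrt 3 \<and> 1 / 3 < (Re z)\<^sup>2 + (Im z)\<^sup>2}"

text \<open>The invariant metric \<open>(dx\<^sup>2 + dy\<^sup>2) / y\<^sup>2\<close> at the point \<open>z\<close> of the upper half-plane,
  evaluated on the tangent vectors \<open>v\<close>, \<open>w\<close>.\<close>

definition half_plane_metric :: "complex \<Rightarrow> complex \<Rightarrow> complex \<Rightarrow> real" where
  "half_plane_metric z v w = (Re v * Re w + Im v * Im w) / (Im z)\<^sup>2"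

lemma Z_mat_in_sl2: "Z_mat u \<in> sl2"
  by (cases u) (simp add: sl2_def trace_def sum_2 field_simps)

lemma Phi_in_sl2: "Phi z \<in> sl2"
  by (simp add: sl2_def trace_def sum_2 Phi_def)

lemma trace_form_Z_mat_Phi_neg:
  assumes "u \<in> U_T" and "z \<in> h_star"
  shows "trace_form (Z_mat u) (Phi z) < 0"
proof -
  obtain u0 u1 u2 where u: "u = (u0, u1, u2)" by (cases u)
  define x y where "x = Re z" and "y = Im z"
  have U: "0 \<le> u0" "0 \<le> u1" "0 \<le> u2" "u0 + u1 + u2 = 1"
    using assms(1) by (auto simp: U_T_def u)
  have y: "0 < y" and x: "\<bar>x\<bar> < 1 / sqrt 3" and n: "1 / 3 < x\<^sup>2 + y\<^sup>2"
    using assms(2) by (auto simp: h_star_def x_def y_def)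
  define s where "s = 1 / sqrt 3"
  have s: "0 < s" "s * s = 1 / 3" "\<bar>x\<bar> < s" using x by (auto simp: s_def)
  have "x * s < s * s" "- x * s < s * s"
    by (rule mult_strict_right_mono; use s in linarith)+
  then have xs: "2 * x * s - 2/3 < 0" "- 2 * x * s - 2/3 < 0" 
    using s by (auto simp: mult.commute)
  define A B C where "A = 1/3 - (x\<^sup>2 + y\<^sup>2)" and "B = 2 * x * s - 2/3" and "C = - 2 * x * s - 2/3"
  have neg: "A < 0" "B < 0" "C < 0" using xs n by (auto simp: A_def B_def C_def)
  have le: "u0 * A \<le> 0" "u1 * B \<le> 0" "u2 * C \<le> 0"
    using neg U by (auto intro!: mult_nonneg_nonpos)
  have "u0 \<noteq> 0 \<or> u1 \<noteq> 0 \<or> u2 \<noteq> 0" using U(4) by auto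
  then have "u0 * A < 0 \<or> u1 * B < 0 \<or> u2 * C < 0"
    using neg U by (metis mult_pos_neg order_le_less)
  then have sum: "u0 * A + u1 * B + u2 * C < 0" using le by linarith
  have "trace_form (Z_mat u) (Phi z) = (u0 * A + u1 * B + u2 * C) / y"
    using y by (simp add: trace_form_def trace_def matrix_matrix_mult_def sum_2 u Phi_def
        A_def B_def C_def s_def flip: x_def y_def) (simp add: divide_simps, simp add: algebra_simps)
  then show ?thesis using sum y by (simp add: divide_neg_pos)
qed

end

theory Submission
  imports Defs
begin

text \<open>Since \<open>\<langle>Z, [Z, X]\<rangle> = 0\<close>, the denominator \<open>c = \<langle>Z, X\<rangle>\<close> is a first integral, and for traceless
  matrices \<open>\<langle>[Z, X], [Z, X]\<rangle> = 2 \<langle>Z, X\<rangle>\<^sup>2 - 8 det Z det X\<close>. As \<open>det (\<Phi> z) = 1\<close>, the squared speed of \<open>X\<close>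
  is \<open>(2 c\<^sup>2 - 8 det Z) / c\<^sup>2\<close>, a constant. Inverting \<open>\<Phi>\<close> by \<open>y = 1 / X\<^sub>2\<^sub>1\<close> and \<open>x = X\<^sub>1\<^sub>1 / X\<^sub>2\<^sub>1\<close>
  shows that \<open>z\<close> is differentiable and that \<open>\<Phi>\<close> multiplies the invariant metric by \<open>2\<close>.\<close>

lemma trace_form_bracket_self: "trace_form Z (bracket Z X) = 0"
  by (simp add: trace_form_def bracket_def trace_def matrix_matrix_mult_def sum_2 algebra_simps)

text \<open>By Cayley-Hamilton, traceless \<open>X\<close> satisfies
  \<open>X ** X = - det X *\<^sub>R mat 1\<close>; polarizing, \<open>Z ** X + X ** Z\<close> is
  \<open>trace_form Z X\<close> times the identity. These reduce the trace of the squared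
  bracket.\<close>

lemma trace_form_bracket_bracket:
  assumes "Z \<in> sl2" "X \<in> sl2"
  shows "trace_form (bracket Z X) (bracket Z X) = 2 * (trace_form Z X)\<^sup>2 - 8 * det Z * det X"
proof -
  have "Z $ 2 $ 2 = - Z $ 1 $ 1" "X $ 2 $ 2 = - X $ 1 $ 1"
    using assms by (simp_all add: sl2_def trace_def sum_2)
  then show ?thesis
    by (simp add: trace_form_def bracket_def trace_def matrix_matrix_mult_def sum_2 det_2
        power2_eq_square algebra_simps)
qed

lemma trace_form_scaleR: "trace_form (a *\<^sub>R A) (b *\<^sub>R B) = a * b * trace_form A B"
  by (simp add: trace_form_def trace_def matrix_matrix_mult_def sum_2 algebra_simps)

lemma bounded_linear_trace_form: "bounded_linear (trace_form A)"
  unfolding linear_conv_bounded_linear[symmetric]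
  by (rule linearI)
    (simp_all add: trace_form_def trace_def matrix_matrix_mult_def sum_2 algebra_simps)

lemma det_Phi: "Im z \<noteq> 0 \<Longrightarrow> det (Phi z) = 1"
  by (simp add: Phi_def det_2 power2_eq_square field_simps)

lemma Phi_inverse:
  assumes "Im z \<noteq> 0"
  shows "z = Complex (Phi z $ 1 $ 1 / Phi z $ 2 $ 1) (1 / Phi z $ 2 $ 1)"
  using assms by (simp add: Phi_def complex_eq_iff)

text \<open>The hypothesis on \<open>trace_form X B\<close> says that \<open>B\<close> is tangent to \<open>{X. det X = 1}\<close> at \<open>X\<close>,
  and \<open>v\<close> is the image of \<open>B\<close> under the differential of \<open>Phi\<close> inverse.\<close>

lemma half_plane_metric_eq_trace_form:
  assumes "Im z \<noteq> 0" and "B \<in> sl2" and "trace_form (Phi z) B = 0"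
  defines "X \<equiv> Phi z"
  defines "v \<equiv> Complex ((B $ 1 $ 1 * X $ 2 $ 1 - X $ 1 $ 1 * B $ 2 $ 1) / (X $ 2 $ 1)\<^sup>2)
                       (- B $ 2 $ 1 / (X $ 2 $ 1)\<^sup>2)"
  shows "half_plane_metric z v v = trace_form B B / 2"
proof -
  define x y p q r where "x = Re z" and "y = Im z" and "p = B $ 1 $ 1" and "q = B $ 1 $ 2" 
    and "r = B $ 2 $ 1"
  have y: "y \<noteq> 0" using assms by (simp add: y_def)
  have p: "B $ 2 $ 2 = - p"
    using assms(2) by (simp add: sl2_def trace_def sum_2 p_def)
  have "2 * (x / y) * p + - (x\<^sup>2 + y\<^sup>2) / y * r + q / y = 0"
    using assms(3) p by (simp add: mult_ac trace_form_def trace_def matrix_matrix_mult_def sum_2 Phi_def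
        flip: x_def y_def p_def q_def r_def)
  \<comment> \<open>Tangency, solved for the upper right entry of \<open>B\<close>.\<close>
  then have q: "q = (x\<^sup>2 + y\<^sup>2) * r - 2 * x * p"
    using y by (simp add: field_simps)
  have "half_plane_metric z v v = (p - x * r)\<^sup>2 + (y * r)\<^sup>2"
    using y by (simp add: half_plane_metric_def v_def X_def Phi_def power2_eq_square 
        flip: x_def y_def p_def q_def r_def) (simp add: field_simps)
  also have "\<dots> = p * p + q * r"
    by (simp add: q power2_eq_square algebra_simps)
  also have "\<dots> = trace_form B B / 2"
    by (simp add: trace_form_def trace_def matrix_matrix_mult_def sum_2 p
        flip: p_def q_def r_def)
  finally show ?thesis .
qed

text \<open>Differentiability passes from \<open>X\<close> to \<open>z\<close>: the quotient rule
  applies to the entries of \<open>X\<close> in \<open>Phi_inverse\<close>.\<close>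

lemma has_vector_derivative_Phi_inverse:
  assumes X: "(X has_vector_derivative B) (at t within I)" and t: "t \<in> I"
    and eq: "\<And>s. s \<in> I \<Longrightarrow> X s = Phi (z s)" and im: "\<And>s. s \<in> I \<Longrightarrow> Im (z s) \<noteq> 0"
  shows "(z has_vector_derivative
           Complex ((B $ 1 $ 1 * X t $ 2 $ 1 - X t $ 1 $ 1 * B $ 2 $ 1) / (X t $ 2 $ 1)\<^sup>2)
                   (- B $ 2 $ 1 / (X t $ 2 $ 1)\<^sup>2)) (at t within I)"
proof -
  have entry: "((\<lambda>s. X s $ i $ j) has_real_derivative B $ i $ j) (at t within I)" for i j
    unfolding has_real_derivative_iff_has_vector_derivative
    by (intro bounded_linear.has_vector_derivative[OF bounded_linear_vec_nth] X)
  have nz: "X t $ 2 $ 1 \<noteq> 0"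
    using im[OF t] by (simp add: eq[OF t] Phi_def)
  have "((\<lambda>s. Complex (X s $ 1 $ 1 / X s $ 2 $ 1) (1 / X s $ 2 $ 1)) has_vector_derivative
           Complex ((B $ 1 $ 1 * X t $ 2 $ 1 - X t $ 1 $ 1 * B $ 2 $ 1) / (X t $ 2 $ 1)\<^sup>2)
                   (- B $ 2 $ 1 / (X t $ 2 $ 1)\<^sup>2)) (at t within I)"
    unfolding has_vector_derivative_complex_iff
    by (auto intro!: derivative_eq_intros entry simp: nz power2_eq_square)
  then show ?thesis
    by (rule has_vector_derivative_transform[rotated 2]) (use t Phi_inverse im eq in auto)
qed

theorem lemma7p1p2:
  fixes u :: "real \<times> real \<times> real"
    and z :: "real \<Rightarrow> complex"
    and X :: "real \<Rightarrow> real^2^2"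
    and I :: "real set"
  assumes "u \<in> U_T"
    and "is_interval I" and "interior I \<noteq> {}"
    and "\<And>t. t \<in> I \<Longrightarrow> z t \<in> h_star"
    and "\<And>t. t \<in> I \<Longrightarrow> X t = Phi (z t)"
    and "\<And>t. t \<in> I \<Longrightarrow>
          (X has_vector_derivative
             bracket (Z_mat u) (X t) /\<^sub>R trace_form (Z_mat u) (X t)) (at t within I)"
  shows "(\<forall>t\<in>I. 0 \<le> trace_form (vector_derivative X (at t within I))
                                (vector_derivative X (at t within I)))
       \<and> (\<lambda>t. sqrt (trace_form (vector_derivative X (at t within I))
                                (vector_derivative X (at t within I)))) constant_on I
       \<and> z differentiable_on I
       \<and> (\<lambda>t. sqrt (half_plane_metric (z t) (vector_derivative z (at t within I))
                                             (vector_derivative z (at t within I)))) constant_on I"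
proof -
  define c B where "c = (\<lambda>t. trace_form (Z_mat u) (X t))"
    and "B = (\<lambda>t. bracket (Z_mat u) (X t) /\<^sub>R c t)"
  have im: "Im (z t) \<noteq> 0" if "t \<in> I" for t
    using assms(4)[OF that] by (simp add: h_star_def)
  have X': "(X has_vector_derivative B t) (at t within I)" if "t \<in> I" for t
    using assms(6)[OF that] by (simp add: B_def c_def)
  have "(c has_real_derivative 0) (at t within I)" if "t \<in> I" for t
    using bounded_linear.has_vector_derivative[OF bounded_linear_trace_form X'[OF that],
        of "Z_mat u"] trace_form_scaleR[of 1 "Z_mat u" "inverse (c t)" "bracket (Z_mat u) (X t)"]
    by (simp add: has_real_derivative_iff_has_vector_derivative c_def B_def trace_form_bracket_self)
  then obtain k where k: "\<And>t. t \<in> I \<Longrightarrow> c t = k"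
    using has_field_derivative_zero_constant[of I c] assms(2) is_interval_convex by blast
  define v where "v = (\<lambda>t. Complex
      ((B t $ 1 $ 1 * X t $ 2 $ 1 - X t $ 1 $ 1 * B t $ 2 $ 1) / (X t $ 2 $ 1)\<^sup>2)
      (- B t $ 2 $ 1 / (X t $ 2 $ 1)\<^sup>2))"
  have z': "(z has_vector_derivative v t) (at t within I)" if "t \<in> I" for t
    unfolding v_def using X'[OF that] that assms(5) im by (rule has_vector_derivative_Phi_inverse)
  \<comment> \<open>\<open>vector_derivative\<close> is determined only at limit points of
    \<open>I\<close>. A nonempty interior rules out a singleton, and a connected set with more than
    one point has no isolated points.\<close>
  have nontriv: "at t within I \<noteq> bot" if "t \<in> I" for t
  proof -
    have "I \<noteq> {t}"
      using assms(3) by auto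
    moreover have "connected I"
      using assms(2) by (simp add: is_interval_connected)
    ultimately show ?thesis
      using connected_imp_perfect that by (auto simp: trivial_limit_within)
  qed
  have vX: "vector_derivative X (at t within I) = B t" 
    and vz: "vector_derivative z (at t within I) = v t" if "t \<in> I" for t
    using vector_derivative_within[OF nontriv] X' z' that by blast+
  have speed: "trace_form (B t) (B t) = (2 * k\<^sup>2 - 8 * det (Z_mat u)) / k\<^sup>2" if "t \<in> I" for t
    using that by (simp add: B_def trace_form_scaleR trace_form_bracket_bracket Z_mat_in_sl2
        Phi_in_sl2 assms(5) det_Phi im flip: k)
      (simp add: c_def assms(5) power2_eq_square divide_inverse)
  have metric: "half_plane_metric (z t) (v t) (v t) = trace_form (B t) (B t) / 2" if "t \<in> I" for t
  proof -
    \<comment> \<open>A commutator is traceless, and \<open>[Z, X]\<close> is orthogonal to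
      \<open>X\<close> by cyclicity of the trace.\<close>
    have "B t \<in> sl2" "trace_form (Phi (z t)) (B t) = 0"
      using that by (simp_all add: B_def assms(5) bracket_def sl2_def trace_form_def trace_def
          matrix_matrix_mult_def sum_2 algebra_simps)
    then show ?thesis
      using half_plane_metric_eq_trace_form im that by (simp add: v_def assms(5))
  qed
  \<comment> \<open>The trace form is indefinite on \<open>sl2\<close>; it is nonnegative on
    \<open>B t\<close> because there it is twice a Riemannian square.\<close>
  have "0 \<le> half_plane_metric w a a" for w a
    by (simp add: half_plane_metric_def)
  then have "0 \<le> trace_form (B t) (B t)" if "t \<in> I" for t
    using metric[OF that] by (metis zero_le_divide_iff not_numeral_less_zero order_less_le zero_less_numeral linorder_not_le)
  moreover have "z differentiable_on I"
    using z' by (auto simp: differentiable_on_def has_vector_derivative_def differentiable_def)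
  ultimately show ?thesis
    by (auto simp: constant_on_def vX vz metric speed)
qed

end
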